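(* Let $T=(V,E)$ be a finite tree with at least three vertices, with its set of leaves as boundary $B$ and interior $\Omega=V\setminus B$. Then $$\lambda_1(T)\ \leq\ \frac{|B|}{|\Omega|}.$$ Equality holds if and only if $|B|$ is divisible by $|\Omega|$ and each interior vertex is adjacent to exactly $|B|/|\Omega|$ leaves.
   Context: For a finite tree $T=(V,E)$ with at least three vertices, the boundary $B$ is the set of leaves (degree-one vertices) and the interior is $\Omega=V\setminus B$. The first Dirichlet eigenvalue $\lambda_1(T)=\lambda_1(T,B)$ is the smallest $\lambda$ for which there is a nonzero $f:V\to\mathbb{R}$ with $f=0$ on $B$ and $\sum_{y\sim x}(f(x)-f(y))=\lambda f(x)$ for all $x\in\Omega$. Equivalently, $\lambda_1(T)=\min \frac{\sum_{\{x,y\}\in E}(f(x)-f(y))^2}{\sum_{x\in\Omega}f(x)^2}$ over nonzero $f:V\to\mathbb{R}$ vanishing on $B$. *)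

theory Defs
  imports Complex_Main "Graph_Theory.Digraph_Component"
begin

text \<open>
  A finite simple graph is a \<^locale>\<open>pair_graph\<close>: a finite vertex set \<^term>\<open>pverts G\<close> and a
  symmetric irreflexive adjacency relation \<^term>\<open>parcs G\<close> on it. The library's \<open>tree\<close> is not
  usable for such graphs, because there the walk along an edge and back counts as a cycle;
  an undirected cycle is a library cycle of length at least three. \<open>connected\<close> is the library's
  notion of connected graph and includes that the vertex set is nonempty.
\<close>

definition finite_tree :: "'a pair_pre_digraph \<Rightarrow> bool" where
  "finite_tree T \<longleftrightarrow>
     pair_graph T \<and> Digraph_Component.connected (with_proj T) \<and>
     \<not> (\<exists>p. pre_digraph.cycle (with_proj T) p \<and> length p \<ge> 3)"

text \<open>By symmetry of the arcs, the out-degree is the degree in the undirected graph.\<close>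

definition tree_boundary :: "'a pair_pre_digraph \<Rightarrow> 'a set" where
  "tree_boundary T = {v \<in> pverts T. out_degree (with_proj T) v = 1}"

definition tree_interior :: "'a pair_pre_digraph \<Rightarrow> 'a set" where
  "tree_interior T = pverts T - tree_boundary T"

text \<open>
  Functions \<open>V \<rightarrow> \<real>\<close> are total functions on the vertex type; their values outside the vertex set
  play no role, so being nonzero is required on the vertex set.
\<close>

definition dirichlet_eigenvalue :: "'a pair_pre_digraph \<Rightarrow> 'a set \<Rightarrow> real \<Rightarrow> bool" where
  "dirichlet_eigenvalue G B \<mu> \<longleftrightarrow>
     (\<exists>f :: 'a \<Rightarrow> real.
        (\<exists>x\<in>pverts G. f x \<noteq> 0) \<and>
        (\<forall>x\<in>B. f x = 0) \<and>
        (\<forall>x\<in>pverts G - B. (\<Sum>y | (x, y) \<in> parcs G. f x - f y) = \<mu> * f x))"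

definition lambda1 :: "'a pair_pre_digraph \<Rightarrow> 'a set \<Rightarrow> real" where
  "lambda1 G B = (LEAST \<mu>. dirichlet_eigenvalue G B \<mu>)"

end

theory Submission
  imports Defs "HOL-Analysis.Function_Topology"
begin

text \<open>
  The eigenvalue \<open>\<lambda>\<^sub>1\<close> is the minimum of the Rayleigh quotient, and every minimiser is an
  eigenfunction. Connectivity and \<open>|V| \<ge> 3\<close> force each leaf to hang on an interior vertex, so the
  indicator of \<open>\<Omega>\<close> has Rayleigh quotient \<open>|B| / |\<Omega>|\<close>. If this is the minimum, the indicator is an
  eigenfunction, and its Laplacian at an interior vertex is the number of adjacent leaves.
  Conversely, if every interior vertex has \<open>k\<close> leaves, the edges into \<open>B\<close> alone contribute
  \<open>k * (\<Sum>x\<in>\<Omega>. (g x)\<^sup>2)\<close> to the energy of any \<open>g\<close> vanishing on \<open>B\<close>.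
\<close>

section \<open>Laplacian, energy and lower bounds for the Rayleigh quotient\<close>

definition laplacian :: "'a pair_pre_digraph \<Rightarrow> ('a \<Rightarrow> real) \<Rightarrow> 'a \<Rightarrow> real" where
  "laplacian G f x = (\<Sum>y | (x, y) \<in> parcs G. f x - f y)"

definition energy :: "'a pair_pre_digraph \<Rightarrow> ('a \<Rightarrow> real) \<Rightarrow> real" where
  "energy G f = (\<Sum>(x, y)\<in>parcs G. (f x - f y)\<^sup>2) / 2" \<comment> \<open>each edge is a pair of opposite arcs\<close>

text \<open>Summing over all vertices makes the form independent of \<open>B\<close>; for functions
  vanishing on \<open>B\<close> it is the denominator of the Rayleigh quotient.\<close>

definition sqnorm :: "'a pair_pre_digraph \<Rightarrow> ('a \<Rightarrow> real) \<Rightarrow> real" where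
  "sqnorm G f = (\<Sum>x\<in>pverts G. (f x)\<^sup>2)"

text \<open>Lower bounds of the Rayleigh quotient in multiplied-out form, so that functions
  vanishing on the whole vertex set require no case distinction.\<close>

definition energy_bound :: "'a pair_pre_digraph \<Rightarrow> 'a set \<Rightarrow> real \<Rightarrow> bool" where
  "energy_bound G B \<mu> \<longleftrightarrow> (\<forall>g. (\<forall>x\<in>B. g x = 0) \<longrightarrow> \<mu> * sqnorm G g \<le> energy G g)"

lemma energy_nonneg: "0 \<le> energy G f"
  unfolding energy_def by (auto intro!: sum_nonneg)

context pair_pseudo_graph
begin

section \<open>Sums over arcs and Green's formula\<close>

lemma arcs_swap: "(x, y) \<in> parcs G \<longleftrightarrow> (y, x) \<in> parcs G"
  using pair_sym_arcs by (auto simp: symmetric_def sym_def)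

lemma finite_neighbours: "finite {y. (x, y) \<in> parcs G}"
  by (rule finite_subset[OF _ pair_finite_verts]) (auto dest: in_arcsD2)

lemma sum_arcs_swap: "(\<Sum>(x, y)\<in>parcs G. h y x) = (\<Sum>(x, y)\<in>parcs G. h x y)"
  by (rule sum.reindex_bij_witness[of _ prod.swap prod.swap]) (auto simp: arcs_swap)

lemma sum_arcs: "(\<Sum>(x, y)\<in>parcs G. h x y) = (\<Sum>x\<in>pverts G. \<Sum>y | (x, y) \<in> parcs G. h x y)"
proof -
  have "parcs G = Sigma (pverts G) (\<lambda>x. {y. (x, y) \<in> parcs G})"
    by (auto dest: in_arcsD1)
  then show ?thesis
    using sum.Sigma[OF pair_finite_verts, of "\<lambda>x. {y. (x, y) \<in> parcs G}" h] finite_neighbours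
    by simp
qed

text \<open>Split the product into a \<open>g x\<close> part and a \<open>g y\<close> part;
  reversing arcs carries one into the other. The factor 2 appears because each edge is a pair of
  opposite arcs.\<close>

lemma green:
  "(\<Sum>(x, y)\<in>parcs G. (f x - f y) * (g x - g y)) = 2 * (\<Sum>x\<in>pverts G. g x * laplacian G f x)"
proof -
  let ?S = "\<Sum>(x, y)\<in>parcs G. (f x - f y) * g x"
  have "(\<Sum>(x, y)\<in>parcs G. (f x - f y) * (g x - g y))
      = ?S + (\<Sum>(x, y)\<in>parcs G. (f y - f x) * g y)"
    by (simp add: sum.distrib[symmetric] case_prod_unfold algebra_simps)
  also have "(\<Sum>(x, y)\<in>parcs G. (f y - f x) * g y) = ?S"
    by (rule sum_arcs_swap)
  also have "?S = (\<Sum>x\<in>pverts G. g x * laplacian G f x)"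
    by (simp add: sum_arcs laplacian_def sum_distrib_left mult.commute)
  finally show ?thesis by simp
qed

lemma energy_laplacian: "energy G f = (\<Sum>x\<in>pverts G. f x * laplacian G f x)"
  using green[of f f] by (simp add: energy_def power2_eq_square)

text \<open>Second-order expansion of a quadratic form along a line; \<open>green\<close> turns the
  cross term into a pairing with the Laplacian, which is the first variation of the energy.\<close>

lemma energy_add:
  "energy G (\<lambda>x. f x + t * g x) =
     energy G f + 2 * t * (\<Sum>x\<in>pverts G. g x * laplacian G f x) + t\<^sup>2 * energy G g"
proof -
  have "(\<Sum>(x, y)\<in>parcs G. ((f x + t * g x) - (f y + t * g y))\<^sup>2) =
      (\<Sum>(x, y)\<in>parcs G. (f x - f y)\<^sup>2 + 2 * t * ((f x - f y) * (g x - g y)) + t\<^sup>2 * (g x - g y)\<^sup>2)"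
    by (intro sum.cong refl) (auto simp: power2_eq_square algebra_simps)
  also have "\<dots> = (\<Sum>(x, y)\<in>parcs G. (f x - f y)\<^sup>2)
      + 2 * t * (\<Sum>(x, y)\<in>parcs G. (f x - f y) * (g x - g y))
      + t\<^sup>2 * (\<Sum>(x, y)\<in>parcs G. (g x - g y)\<^sup>2)"
    by (simp add: sum.distrib sum_distrib_left case_prod_unfold)
  finally show ?thesis
    unfolding energy_def green by (simp add: add_divide_distrib)
qed

lemma sqnorm_add:
  "sqnorm G (\<lambda>x. f x + t * g x) = sqnorm G f + 2 * t * (\<Sum>x\<in>pverts G. g x * f x) + t\<^sup>2 * sqnorm G g"
  unfolding sqnorm_def
  by (simp add: sum.distrib[symmetric] sum_distrib_left power2_eq_square algebra_simps)

lemma sqnorm_pos: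
  assumes "x \<in> pverts G" "f x \<noteq> 0"
  shows "0 < sqnorm G f"
  unfolding sqnorm_def using assms pair_finite_verts by (intro sum_pos2[of _ x]) auto

section \<open>Eigenvalues and minimisers of the Rayleigh quotient\<close>

lemma eigenfunction_energy:
  assumes "\<forall>x\<in>B. f x = 0" "\<forall>x\<in>pverts G - B. laplacian G f x = \<mu> * f x"
  shows "energy G f = \<mu> * sqnorm G f"
proof -
  have "f x * laplacian G f x = \<mu> * (f x)\<^sup>2" if "x \<in> pverts G" for x
    using assms that by (cases "x \<in> B") (auto simp: power2_eq_square)
  then show ?thesis
    by (simp add: energy_laplacian sqnorm_def sum_distrib_left)
qed

text \<open>An eigenfunction for \<open>\<nu>\<close> is admissible and has Rayleigh quotient
  exactly \<open>\<nu>\<close>.\<close>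

lemma energy_bound_le_eigenvalue:
  assumes "energy_bound G B \<mu>" "dirichlet_eigenvalue G B \<nu>"
  shows "\<mu> \<le> \<nu>"
proof -
  obtain f x where x: "x \<in> pverts G" "f x \<noteq> 0" and f0: "\<forall>x\<in>B. f x = 0"
    and f: "\<forall>x\<in>pverts G - B. laplacian G f x = \<nu> * f x"
    using assms(2) unfolding dirichlet_eigenvalue_def laplacian_def[symmetric] by blast
  have "\<mu> * sqnorm G f \<le> energy G f"
    using assms(1) f0 by (simp add: energy_bound_def)
  also have "energy G f = \<nu> * sqnorm G f"
    by (rule eigenfunction_energy[OF f0 f])
  finally show ?thesis
    using sqnorm_pos[of x f] x by simp
qed

text \<open>Perturb \<open>f\<close> at the single vertex \<open>x\<close>, which keeps it zero on
  \<open>B\<close>. The excess of energy over \<open>\<mu>\<close> times the square norm is then a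
  nonnegative quadratic in the step \<open>t\<close> without constant term, so its linear
  coefficient vanishes.\<close>

lemma minimiser_eigenfunction:
  assumes bound: "energy_bound G B \<mu>" and f0: "\<forall>x\<in>B. f x = 0"
    and f: "energy G f = \<mu> * sqnorm G f" and x: "x \<in> pverts G - B"
  shows "laplacian G f x = \<mu> * f x"
proof -
  define g :: "'a \<Rightarrow> real" where "g = (\<lambda>y. if y = x then 1 else 0)"
  define a where "a = laplacian G f x - \<mu> * f x"
  define c where "c = energy G g - \<mu> * sqnorm G g"
  have g_sum: "(\<Sum>y\<in>pverts G. g y * h y) = h x" for h
  proof -
    have "(\<Sum>y\<in>pverts G. g y * h y) = (\<Sum>y\<in>pverts G. if y = x then h y else 0)"
      by (intro sum.cong) (auto simp: g_def)
    then show ?thesis using x pair_finite_verts by simp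
  qed
  have pos: "0 \<le> 2 * t * a + t\<^sup>2 * c" for t
  proof -
    have "\<forall>y\<in>B. f y + t * g y = 0"
      using f0 x by (auto simp: g_def)
    then have "\<mu> * sqnorm G (\<lambda>y. f y + t * g y) \<le> energy G (\<lambda>y. f y + t * g y)"
      using bound by (simp add: energy_bound_def)
    then show ?thesis
      unfolding energy_add sqnorm_add g_sum f a_def c_def by (simp add: algebra_simps)
  qed
  have "a = 0" \<comment> \<open>otherwise the quadratic in \<open>t\<close> is negative at \<open>t = - a / (c + 1)\<close>\<close>
  proof (rule ccontr)
    assume "a \<noteq> 0"
    have "0 \<le> c" using pos[of 1] pos[of "-1"] by simp
    \<comment> \<open>Dividing by \<open>c + 1\<close> instead of \<open>c\<close> covers the case
      \<open>c = 0\<close> as well.\<close>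
    have "2 * (- a / (c + 1)) * a + (- a / (c + 1))\<^sup>2 * c = - (a\<^sup>2 * (c + 2)) / (c + 1)\<^sup>2"
      using \<open>0 \<le> c\<close> by (simp add: divide_simps) (simp add: power2_eq_square algebra_simps)
    also have "\<dots> < 0"
      using \<open>0 \<le> c\<close> \<open>a \<noteq> 0\<close> by (simp add: divide_neg_pos)
    finally show False using pos[of "- a / (c + 1)"] by simp
  qed
  then show ?thesis by (simp add: a_def)
qed

section \<open>Existence of a minimiser by compactness\<close>

lemma continuous_on_energy: "continuous_on S (energy G)"
proof -
  have "continuous_on UNIV (\<lambda>f. energy G f)"
    unfolding energy_def case_prod_unfold by (intro continuous_intros) auto
  then show ?thesis by (rule continuous_on_subset) simp
qed

lemma continuous_on_sqnorm: "continuous_on S (sqnorm G)"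
proof -
  have "continuous_on UNIV (\<lambda>f. sqnorm G f)"
    unfolding sqnorm_def by (intro continuous_intros) auto
  then show ?thesis by (rule continuous_on_subset) simp
qed

lemma exists_minimiser:
  assumes "B \<subseteq> pverts G" and ne: "pverts G - B \<noteq> {}"
  obtains \<mu> f where "energy_bound G B \<mu>" "\<exists>x\<in>pverts G. f x \<noteq> 0" "\<forall>x\<in>B. f x = 0"
    "energy G f = \<mu> * sqnorm G f"
proof -
  \<comment> \<open>The vertex type may be infinite, so all coordinates off the interior are pinned
    to 0 and compactness comes from Tychonoff's theorem. The bounds -1 and 1 cut nothing off the
    unit sphere.\<close>
  define S :: "'a \<Rightarrow> real set" where "S = (\<lambda>x. if x \<in> pverts G - B then {-1..1} else {0})"
  define K where "K = PiE UNIV S \<inter> {f. sqnorm G f = 1}"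
  have "compactin euclidean (PiE UNIV S)"
    unfolding euclidean_product_topology[symmetric] compactin_PiE by (auto simp: S_def)
  moreover have "closed {f. sqnorm G f = 1}"
    by (intro closed_Collect_eq continuous_on_sqnorm continuous_on_const)
  ultimately have "compact K"
    unfolding K_def by (intro compact_Int_closed) auto
  moreover have "K \<noteq> {}"
  proof -
    obtain z where z: "z \<in> pverts G - B" using ne by blast
    define e :: "'a \<Rightarrow> real" where "e = (\<lambda>y. if y = z then 1 else 0)"
    have "sqnorm G e = (\<Sum>y\<in>pverts G. if y = z then 1 else 0)"
      unfolding sqnorm_def by (intro sum.cong) (auto simp: e_def)
    then have "e \<in> K"
      using z pair_finite_verts by (auto simp: K_def S_def e_def)
    then show ?thesis by blast
  qed
  ultimately have "\<exists>f\<in>K. \<forall>g\<in>K. energy G f \<le> energy G g"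
    by (intro continuous_attains_inf continuous_on_energy)
  then obtain f where f: "f \<in> K" and min: "\<And>g. g \<in> K \<Longrightarrow> energy G f \<le> energy G g"
    by blast
  have fS: "f x \<in> S x" for x using f by (auto simp: K_def)
  have f1: "sqnorm G f = 1" using f by (simp add: K_def)
  show thesis
  proof (rule that[of "energy G f" f])
    show "\<exists>x\<in>pverts G. f x \<noteq> 0"
    proof (rule ccontr)
      assume "\<not> (\<exists>x\<in>pverts G. f x \<noteq> 0)"
      then have "sqnorm G f = 0" by (simp add: sqnorm_def)
      then show False using f1 by simp
    qed
    show "\<forall>x\<in>B. f x = 0"
    proof
      fix x assume "x \<in> B"
      then show "f x = 0" using fS[of x] by (simp add: S_def)
    qed
    show "energy G f = energy G f * sqnorm G f" by (simp add: f1)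
    show "energy_bound G B (energy G f)"
      unfolding energy_bound_def
    proof (intro allI impI)
      fix g :: "'a \<Rightarrow> real" assume g0: "\<forall>x\<in>B. g x = 0"
      show "energy G f * sqnorm G g \<le> energy G g"
      proof (cases "sqnorm G g = 0")
        case True
        then show ?thesis by (simp add: energy_nonneg)
      next
        case False
        define s where "s = sqrt (sqnorm G g)"
        have nonneg: "0 \<le> sqnorm G g" unfolding sqnorm_def by (auto intro!: sum_nonneg)
        then have s: "s\<^sup>2 = sqnorm G g" "0 < s" using False by (auto simp: s_def)
        \<comment> \<open>Normalise \<open>g\<close> and cut it to 0 outside the vertex set to land
          in \<open>K\<close>; energy and square norm only see values at vertices and scale by the
          same factor.\<close>
        define h where "h = (\<lambda>x. if x \<in> pverts G then g x / s else 0)"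
        have "sqnorm G h = sqnorm G g / s\<^sup>2"
          unfolding sqnorm_def h_def by (simp add: power_divide sum_divide_distrib)
        then have h1: "sqnorm G h = 1" using s False by simp
        have "h x \<in> S x" for x
        proof (cases "x \<in> pverts G - B")
          case True
          have "(h x)\<^sup>2 \<le> sqnorm G h"
            unfolding sqnorm_def using True pair_finite_verts by (intro member_le_sum) auto
          then have "\<bar>h x\<bar> \<le> 1" using h1 by (simp add: abs_square_le_1)
          then show ?thesis using True by (auto simp: S_def)
        next
          case False
          then show ?thesis using g0 by (auto simp: S_def h_def)
        qed
        then have "h \<in> K" using h1 by (auto simp: K_def)
        then have "energy G f \<le> energy G h" by (rule min)
        also have "energy G h = energy G g / s\<^sup>2"
        proof -
          have "(\<Sum>(x, y)\<in>parcs G. (h x - h y)\<^sup>2) = (\<Sum>(x, y)\<in>parcs G. (g x - g y)\<^sup>2 / s\<^sup>2)"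
            by (intro sum.cong)
              (auto simp: h_def diff_divide_distrib[symmetric] power_divide dest: in_arcsD1 in_arcsD2)
          then show ?thesis
            by (simp add: energy_def sum_divide_distrib case_prod_unfold mult.commute)
        qed
        finally show ?thesis using nonneg False s by (simp add: pos_le_divide_eq)
      qed
    qed
  qed
qed

text \<open>The \<open>LEAST\<close> in \<open>lambda1\<close> says something only once a least
  eigenvalue is exhibited: the attained minimum is an eigenvalue and bounds all others from
  below.\<close>

lemma lambda1_variational:
  assumes "B \<subseteq> pverts G" "pverts G - B \<noteq> {}"
  shows "energy_bound G B (lambda1 G B)" "dirichlet_eigenvalue G B (lambda1 G B)"
proof -
  obtain \<mu> f where \<mu>: "energy_bound G B \<mu>" and nz: "\<exists>x\<in>pverts G. f x \<noteq> 0"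
    and f0: "\<forall>x\<in>B. f x = 0" and f: "energy G f = \<mu> * sqnorm G f"
    using exists_minimiser[OF assms] .
  have ev: "dirichlet_eigenvalue G B \<mu>"
    unfolding dirichlet_eigenvalue_def laplacian_def[symmetric]
    using nz f0 minimiser_eigenfunction[OF \<mu> f0 f] by blast
  have "lambda1 G B = \<mu>"
    unfolding lambda1_def
  proof (rule Least_equality[of "dirichlet_eigenvalue G B", OF ev])
    fix \<nu> assume "dirichlet_eigenvalue G B \<nu>"
    then show "\<mu> \<le> \<nu>" by (rule energy_bound_le_eigenvalue[OF \<mu>])
  qed
  then show "energy_bound G B (lambda1 G B)" "dirichlet_eigenvalue G B (lambda1 G B)"
    using \<mu> ev by simp_all
qed

section \<open>Edges between interior and boundary\<close>

lemma boundary_energy_le: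
  fixes g :: "'a \<Rightarrow> real"
  assumes "\<forall>x\<in>B. g x = 0"
  shows "(\<Sum>x\<in>pverts G - B. card {y \<in> B. (x, y) \<in> parcs G} * (g x)\<^sup>2) \<le> energy G g"
proof -
  \<comment> \<open>Keeps only arcs entering \<open>B\<close> from outside, where
    \<open>g y = 0\<close> makes the energy term equal to \<open>(g x)\<^sup>2\<close>. Symmetrising
    accounts for the opposite arcs; all other arcs are estimated by 0.\<close>
  define h :: "'a \<Rightarrow> 'a \<Rightarrow> real" where "h = (\<lambda>x y. if x \<notin> B \<and> y \<in> B then (g x)\<^sup>2 else 0)"
  have "(\<Sum>y | (x, y) \<in> parcs G. h x y) =
      (if x \<in> B then 0 else card {y \<in> B. (x, y) \<in> parcs G} * (g x)\<^sup>2)" for x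
  proof (cases "x \<in> B")
    case False
    then have "(\<Sum>y | (x, y) \<in> parcs G. h x y) = (\<Sum>y\<in>{y \<in> B. (x, y) \<in> parcs G}. (g x)\<^sup>2)"
      using finite_neighbours by (intro sum.mono_neutral_cong_right) (auto simp: h_def)
    then show ?thesis using False by simp
  qed (simp add: h_def)
  then have "(\<Sum>x\<in>pverts G - B. card {y \<in> B. (x, y) \<in> parcs G} * (g x)\<^sup>2) =
      (\<Sum>(x, y)\<in>parcs G. h x y)"
    unfolding sum_arcs using pair_finite_verts by (intro sum.mono_neutral_cong_left) auto
  also have "2 * (\<Sum>(x, y)\<in>parcs G. h x y) = (\<Sum>(x, y)\<in>parcs G. h x y + h y x)"
    using sum_arcs_swap[of h] by (simp add: sum.distrib case_prod_unfold)
  then have "(\<Sum>(x, y)\<in>parcs G. h x y) = (\<Sum>(x, y)\<in>parcs G. h x y + h y x) / 2"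
    by simp
  also have "\<dots> \<le> energy G g"
    unfolding energy_def using assms
    by (intro divide_right_mono sum_mono) (auto simp: h_def)
  finally show ?thesis .
qed

lemma laplacian_indicator:
  assumes "x \<in> pverts G - B"
  shows "laplacian G (indicator (- B)) x = card {y \<in> B. (x, y) \<in> parcs G}"
proof -
  have "laplacian G (indicator (- B)) x = (\<Sum>y\<in>{y \<in> B. (x, y) \<in> parcs G}. 1)"
    unfolding laplacian_def using assms finite_neighbours
    by (intro sum.mono_neutral_cong_right) (auto simp: indicator_def)
  then show ?thesis by simp
qed

lemma energy_indicator:
  "energy G (indicator (- B)) = (\<Sum>x\<in>pverts G - B. real (card {y \<in> B. (x, y) \<in> parcs G}))"
  unfolding energy_laplacian using pair_finite_verts
  by (intro sum.mono_neutral_cong_right) (auto simp: laplacian_indicator indicator_def)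

lemma sqnorm_indicator: "sqnorm G (indicator (- B)) = card (pverts G - B)"
proof -
  have "sqnorm G (indicator (- B)) = (\<Sum>x\<in>pverts G - B. 1)"
    unfolding sqnorm_def using pair_finite_verts
    by (intro sum.mono_neutral_cong_right) (auto simp: indicator_def)
  then show ?thesis by simp
qed

end

section \<open>Leaves of a connected graph\<close>

context pair_graph
begin

lemma leaf_neighbours:
  assumes "v \<in> tree_boundary G"
  obtains w where "{y. (v, y) \<in> parcs G} = {w}"
proof -
  have "out_arcs G v = Pair v ` {y. (v, y) \<in> parcs G}"
    by (auto simp: out_arcs_def)
  then have "card (Pair v ` {y. (v, y) \<in> parcs G}) = 1"
    using assms by (simp add: tree_boundary_def out_degree_def)
  then have "card {y. (v, y) \<in> parcs G} = 1"
    by (simp add: card_image inj_on_def)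
  then show thesis using that by (auto simp: card_1_singleton_iff)
qed

text \<open>Two adjacent leaves can reach only each other, so by connectivity they would be the
  whole vertex set, against having three vertices.\<close>

lemma leaf_neighbour_interior:
  assumes conn: "connected G" and card: "3 \<le> card (pverts G)"
    and v: "v \<in> tree_boundary G" and vw: "(v, w) \<in> parcs G"
  shows "w \<in> tree_interior G"
proof (rule ccontr)
  assume "w \<notin> tree_interior G"
  then have w: "w \<in> tree_boundary G"
    using vw by (auto simp: tree_interior_def dest: in_arcsD2)
  have nv: "y = w" if "(v, y) \<in> parcs G" for y
    using leaf_neighbours[OF v] vw that by (metis mem_Collect_eq singletonD)
  have nw: "y = v" if "(w, y) \<in> parcs G" for y
    using leaf_neighbours[OF w] vw arcs_swap that by (metis mem_Collect_eq singletonD)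
  have "pverts G \<subseteq> {v, w}"
  proof
    fix u assume "u \<in> pverts G"
    then have "v \<rightarrow>\<^sup>*\<^bsub>G\<^esub> u"
      using symmetric_connected_imp_strongly_connected[OF pair_sym_arcs conn] vw
      by (auto simp: strongly_connected_def dest: in_arcsD1)
    then show "u \<in> {v, w}"
    proof (induction rule: reachable_induct)
      case (step x y)
      then show ?case using nv nw by auto
    qed simp
  qed
  then have "card (pverts G) \<le> card {v, w}" by (rule card_mono[rotated]) simp
  also have "\<dots> \<le> 2" by (simp add: card_insert_if)
  finally show False using card by simp
qed

lemma interior_nonempty:
  assumes conn: "connected G" and card: "3 \<le> card (pverts G)"
  shows "tree_interior G \<noteq> {}"
proof
  assume e: "tree_interior G = {}"
  obtain v where "v \<in> pverts G" using card by fastforce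
  then have v: "v \<in> tree_boundary G" using e by (auto simp: tree_interior_def)
  then show False
    using leaf_neighbours[OF v] leaf_neighbour_interior[OF conn card v] e by blast
qed

text \<open>Double counting of interior-leaf adjacencies: each leaf has exactly one neighbour, and
  that neighbour is interior.\<close>

lemma sum_leaf_neighbours:
  assumes conn: "connected G" and card: "3 \<le> card (pverts G)"
  shows "(\<Sum>x\<in>tree_interior G. card {y \<in> tree_boundary G. (x, y) \<in> parcs G}) = card (tree_boundary G)"
proof -
  have "finite (tree_interior G)" "finite (tree_boundary G)"
    using pair_finite_verts by (auto simp: tree_interior_def tree_boundary_def)
  moreover have "card {x \<in> tree_interior G. (x, y) \<in> parcs G} = 1" if y: "y \<in> tree_boundary G" for y
  proof -
    obtain w where w: "{x. (y, x) \<in> parcs G} = {w}" using leaf_neighbours[OF y] .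
    then have "{x \<in> tree_interior G. (x, y) \<in> parcs G} = {w}"
      using leaf_neighbour_interior[OF conn card y] arcs_swap by blast
    then show ?thesis by simp
  qed
  ultimately show ?thesis
    using sum_multicount_gen[of "tree_interior G" "tree_boundary G" "\<lambda>x y. (x, y) \<in> parcs G" "\<lambda>_. 1"]
    by simp
qed

end

section \<open>The eigenvalue bound and its equality case\<close>

theorem corollary1p5:
  fixes T :: "'a pair_pre_digraph" and B \<Omega> :: "'a set"
  assumes "finite_tree T"
    and "card (pverts T) \<ge> 3"
    and "B = tree_boundary T"
    and "\<Omega> = tree_interior T"
  shows "lambda1 T B \<le> real (card B) / real (card \<Omega>) \<and>
    (lambda1 T B = real (card B) / real (card \<Omega>) \<longleftrightarrow>
       card \<Omega> dvd card B \<and>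
       (\<forall>x\<in>\<Omega>. card {y \<in> B. (x, y) \<in> parcs T} = card B div card \<Omega>))"
proof -
  interpret pair_graph T using assms(1) by (simp add: finite_tree_def)
  have conn: "connected T" using assms(1) by (simp add: finite_tree_def)
  have \<Omega>: "\<Omega> = pverts T - B" and BV: "B \<subseteq> pverts T"
    using assms by (auto simp: tree_interior_def tree_boundary_def)
  have ne: "pverts T - B \<noteq> {}"
    using interior_nonempty[OF conn assms(2)] assms(4) \<Omega> by simp
  have pos: "0 < card \<Omega>"
    using ne \<Omega> pair_finite_verts by (simp add: card_gt_0_iff)
  define u :: "'a \<Rightarrow> real" where "u = indicator (- B)"
  have u0: "\<forall>x\<in>B. u x = 0" by (simp add: u_def)
  have Eu: "energy T u = card B"
    using sum_leaf_neighbours[OF conn assms(2)] unfolding assms(3,4)[symmetric]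
    by (simp add: u_def energy_indicator \<Omega>[symmetric] flip: of_nat_sum)
  have Nu: "sqnorm T u = card \<Omega>"
    by (simp add: u_def sqnorm_indicator \<Omega>)
  have Lu: "laplacian T u x = card {y \<in> B. (x, y) \<in> parcs T}" if "x \<in> \<Omega>" for x
    using laplacian_indicator that by (simp add: u_def \<Omega>)
  note bound = lambda1_variational(1)[OF BV ne] and ev = lambda1_variational(2)[OF BV ne]
  have le: "lambda1 T B \<le> real (card B) / real (card \<Omega>)"
    using bound u0 Eu Nu pos unfolding energy_bound_def by (force simp: field_simps)
  moreover have "card \<Omega> dvd card B \<and> (\<forall>x\<in>\<Omega>. card {y \<in> B. (x, y) \<in> parcs T} = card B div card \<Omega>)"
    if eq: "lambda1 T B = real (card B) / real (card \<Omega>)"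
  proof -
    have "energy T u = lambda1 T B * sqnorm T u"
      using pos by (simp add: Eu Nu eq)
    from minimiser_eigenfunction[OF bound u0 this]
    have "real (card {y \<in> B. (x, y) \<in> parcs T}) = real (card B) / real (card \<Omega>)" if "x \<in> \<Omega>" for x
      using that Lu by (simp add: \<Omega>[symmetric] eq) (simp add: \<Omega> u_def)
    \<comment> \<open>The eigenvalue equation for \<open>u\<close>, with \<open>u x = 1\<close> on
      the interior, fixes the leaf count at \<open>x\<close>; clearing the denominator gives an
      identity of naturals that yields both divisibility and the quotient.\<close>
    then have card_B: "card B = card {y \<in> B. (x, y) \<in> parcs T} * card \<Omega>" if "x \<in> \<Omega>" for x
      using that pos by (simp add: field_simps flip: of_nat_mult)
    obtain x where "x \<in> \<Omega>" using ne \<Omega> by blast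
    then have "card \<Omega> dvd card B" using card_B by (metis dvd_triv_right)
    moreover have "card {y \<in> B. (x, y) \<in> parcs T} = card B div card \<Omega>" if "x \<in> \<Omega>" for x
      using card_B[OF that] pos by simp
    ultimately show ?thesis by blast
  qed
  moreover have "lambda1 T B = real (card B) / real (card \<Omega>)"
    if dvd: "card \<Omega> dvd card B"
      and k: "\<forall>x\<in>\<Omega>. card {y \<in> B. (x, y) \<in> parcs T} = card B div card \<Omega>"
  proof -
    let ?k = "real (card B) / real (card \<Omega>)"
    have "energy_bound T B ?k"
      unfolding energy_bound_def
    proof (intro allI impI)
      fix g :: "'a \<Rightarrow> real" assume g0: "\<forall>x\<in>B. g x = 0"
      have "sqnorm T g = (\<Sum>x\<in>\<Omega>. (g x)\<^sup>2)"
        unfolding sqnorm_def \<Omega> using g0 pair_finite_verts by (intro sum.mono_neutral_right) auto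
      \<comment> \<open>Divisibility makes the truncating \<open>div\<close> in \<open>k\<close>
        agree with the real quotient.\<close>
      then have "?k * sqnorm T g = (\<Sum>x\<in>\<Omega>. card {y \<in> B. (x, y) \<in> parcs T} * (g x)\<^sup>2)"
        using k dvd by (simp add: sum_distrib_left real_of_nat_div)
      also have "\<dots> \<le> energy T g"
        using boundary_energy_le[OF g0] by (simp add: \<Omega>)
      finally show "?k * sqnorm T g \<le> energy T g" .
    qed
    then show ?thesis
      \<comment> \<open>Since \<open>lambda1 T B\<close> is itself an eigenvalue, the energy bound
        gives the inequality opposite to \<open>le\<close>.\<close>
      using energy_bound_le_eigenvalue[OF _ ev] le by fastforce
  qed
  ultimately show ?thesis by blast
qed

end
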